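(* Let $G$ be a finite simple graph that contains no induced subgraph isomorphic to $P_3\cup 2K_1$ and no induced subgraph isomorphic to $\overline{P_3\cup 2K_1}$, and suppose $\omega(G)\geq 4$. Let $A=\{v_1,\ldots,v_\omega\}$ be a maximum clique of $G$ ($\omega=\omega(G)$); for $k\in[\omega]$ let $I_k$ be the set of vertices of $V(G)\setminus A$ adjacent to every $v_i$ with $i\neq k$ but not to $v_k$; let $X_1=A\cup\bigcup_{k}I_k$ and $V_2=V(G)\setminus X_1$. Let $A'=\{v'_1,\ldots,v'_m\}$ be a maximum clique of the induced subgraph $\langle V_2\rangle$ (so $m=\omega(\langle V_2\rangle)$); for $k\in[m]$ let $I'_k$ be the set of vertices of $V_2\setminus A'$ adjacent to every $v'_i$ with $i\neq k$ but not to $v'_k$; let $X_2=A'\cup\bigcup_{k=1}^m I'_k$ and $X_3=V_2\setminus X_2$. Then $V(G)=X_1\cup X_2\cup X_3$, where $\langle X_1\rangle$ is a complete multipartite graph, $\langle X_2\rangle$ is a multipartite graph (and a complete multipartite graph if $\omega(\langle V_2\rangle)\geq 4$), and $\langle X_3\rangle$ is a disjoint union of cliques.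
   Context: $P_3\cup 2K_1$ denotes the disjoint union of a path on three vertices and two isolated vertices; $\overline{H}$ is the complement of $H$. $\omega(\cdot)$ is the clique number and $\langle S\rangle$ is the subgraph induced by $S$. $[k]=\{1,\ldots,k\}$. *)

theory Defs
  imports "Graph_Theory.Graph_Theory" "HOL-Library.Disjoint_Sets"
begin

text \<open>
  Finite simple graphs are given by the locale \<^locale>\<open>graph\<close> (finite symmetric digraphs
  without loops and multiple arcs); \<open>u \<rightarrow>\<^bsub>G\<^esub> v\<close> is adjacency and \<open>G \<restriction> S\<close> the subgraph induced by \<open>S\<close>.
\<close>

definition P3_2K1 :: "(nat, nat \<times> nat) pre_digraph" where
  "P3_2K1 = with_proj \<lparr> pverts = {0, 1, 2, 3, 4}, parcs = {(0, 1), (1, 0), (1, 2), (2, 1)} \<rparr>"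

definition complement :: "('a, 'b) pre_digraph \<Rightarrow> ('a, 'a \<times> 'a) pre_digraph" where
  "complement G = with_proj
     \<lparr> pverts = verts G,
       parcs = {(u, v). u \<in> verts G \<and> v \<in> verts G \<and> u \<noteq> v \<and> \<not> u \<rightarrow>\<^bsub>G\<^esub> v} \<rparr>"

definition induced_free :: "('a, 'b) pre_digraph \<Rightarrow> ('c, 'd) pre_digraph \<Rightarrow> bool" where
  "induced_free G F \<longleftrightarrow> \<not> (\<exists>H. induced_subgraph H G \<and> digraph_iso H F)"

definition is_clique :: "('a, 'b) pre_digraph \<Rightarrow> 'a set \<Rightarrow> bool" where
  "is_clique G S \<longleftrightarrow> S \<subseteq> verts G \<and> pairwise (\<lambda>u v. u \<rightarrow>\<^bsub>G\<^esub> v) S"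

definition is_independent :: "('a, 'b) pre_digraph \<Rightarrow> 'a set \<Rightarrow> bool" where
  "is_independent G S \<longleftrightarrow> S \<subseteq> verts G \<and> pairwise (\<lambda>u v. \<not> u \<rightarrow>\<^bsub>G\<^esub> v) S"

text \<open>The empty set is a clique, so the clique number of the null graph is 0.\<close>

definition clique_number :: "('a, 'b) pre_digraph \<Rightarrow> nat" (\<open>\<omega>\<close>) where
  "\<omega> G = Max (card ` {S. is_clique G S})"

definition maximum_clique :: "('a, 'b) pre_digraph \<Rightarrow> 'a set \<Rightarrow> bool" where
  "maximum_clique G S \<longleftrightarrow> is_clique G S \<and> card S = \<omega> G"

text \<open>
  The vertices outside the clique \<open>v 1, \<dots>, v n\<close> of \<open>G\<close> whose only non-neighbour in it is \<open>v k\<close>.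
\<close>

definition missing_only :: "('a, 'b) pre_digraph \<Rightarrow> (nat \<Rightarrow> 'a) \<Rightarrow> nat \<Rightarrow> nat \<Rightarrow> 'a set" where
  "missing_only G v n k =
     {x \<in> verts G - v ` {1..n}. (\<forall>i\<in>{1..n} - {k}. x \<rightarrow>\<^bsub>G\<^esub> v i) \<and> \<not> x \<rightarrow>\<^bsub>G\<^esub> v k}"

definition partite_classes :: "('a, 'b) pre_digraph \<Rightarrow> 'a set set \<Rightarrow> bool" where
  "partite_classes G P \<longleftrightarrow> partition_on (verts G) P \<and> (\<forall>S\<in>P. is_independent G S)"

text \<open>
  The number of classes is a parameter: with an unrestricted number of classes every graph
  would be multipartite, by taking singletons.
\<close>

definition multipartite :: "nat \<Rightarrow> ('a, 'b) pre_digraph \<Rightarrow> bool" where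
  "multipartite n G \<longleftrightarrow> (\<exists>P. partite_classes G P \<and> card P = n)"

definition complete_multipartite :: "('a, 'b) pre_digraph \<Rightarrow> bool" where
  "complete_multipartite G \<longleftrightarrow>
     (\<exists>P. partite_classes G P \<and> (\<forall>S\<in>P. \<forall>T\<in>P. S \<noteq> T \<longrightarrow> (\<forall>u\<in>S. \<forall>w\<in>T. u \<rightarrow>\<^bsub>G\<^esub> w)))"

definition disjoint_union_of_cliques :: "('a, 'b) pre_digraph \<Rightarrow> bool" where
  "disjoint_union_of_cliques G \<longleftrightarrow>
     (\<exists>P. partition_on (verts G) P \<and> (\<forall>S\<in>P. is_clique G S) \<and>
          (\<forall>S\<in>P. \<forall>T\<in>P. S \<noteq> T \<longrightarrow> (\<forall>u\<in>S. \<forall>w\<in>T. \<not> u \<rightarrow>\<^bsub>G\<^esub> w)))"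

end

(*
  In the complement of P3 + 2 K1 a vertex is adjacent to exactly two vertices of a K4, so a
  vertex with at least two non-neighbours in a maximum clique A has at most one neighbour in
  A. Let X consist of A and the vertices with exactly one non-neighbour in A. Suppose that A
  has at least four vertices. Two non-adjacent vertices of different parts of X would, with
  three suitable vertices of A, form the same graph, so the parts are completely joined. If
  exactly one vertex x of an independent triple outside X had a neighbour u in A, then x - u -
  w with a further w in A, together with the rest of the triple, would be an induced P3 + 2
  K1. Hence an independent triple outside X sees at most one vertex of A, an induced P3 + K1
  outside X sees at most two, and it could be completed to an induced P3 + 2 K1: so the rest
  of G is (P3 + K1)-free. Finally, an induced P3 a - b - c in X3 would have every vertex of A'
  adjacent to one of a, b, c, each of which has at most one neighbour and at least two non-
  neighbours in A'. This forces a perfect matching between {a, b, c} and A', which contains an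
  induced P3 + K1.
*)

theory Submission
  imports Defs
begin

section \<open>Induced subgraphs\<close>

lemma dominates_induce_iff:
  "u \<rightarrow>\<^bsub>G \<restriction> S\<^esub> w \<longleftrightarrow> u \<in> S \<and> w \<in> S \<and> u \<rightarrow>\<^bsub>G\<^esub> w"
  by (auto simp: arcs_ends_conv)

lemma induce_induce:
  assumes "T \<subseteq> S"
  shows "(G \<restriction> S) \<restriction> T = G \<restriction> T"
  using assms by (auto simp: induce_subgraph_def)

lemma (in graph) graph_induce:
  assumes "S \<subseteq> verts G"
  shows "graph (G \<restriction> S)"
proof -
  have "symmetric (G \<restriction> S)"
    unfolding symmetric_def
    by (rule symI) (use sym_arcs in \<open>auto simp: dominates_induce_iff dest: arcs_ends_symmetric\<close>)
  moreover have "finite (verts (G \<restriction> S))"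
    using assms finite_subset[OF _ finite_verts] by simp
  moreover have "finite (arcs (G \<restriction> S))"
    by simp
  ultimately show ?thesis
    by unfold_locales
      (auto simp: arc_to_ends_def no_loops intro: no_multi_arcs)
qed

text \<open>An induced subgraph of an induced subgraph is induced in the whole graph. This passes
  the forbidden patterns on to the second stage.\<close>

lemma (in wf_digraph) induced_free_induce:
  assumes "induced_free G F" "S \<subseteq> verts G"
  shows "induced_free (G \<restriction> S) F"
  unfolding induced_free_def
proof safe
  fix H assume H: "induced_subgraph H (G \<restriction> S)" "digraph_iso H F"
  then have "subgraph H (G \<restriction> S)" by auto
  moreover have "subgraph (G \<restriction> S) G"
    using assms(2) induced_induce by blast
  ultimately have "subgraph H G"
    using subgraph_trans by blast
  moreover have "arcs H = {e \<in> arcs G. tail G e \<in> verts H \<and> head G e \<in> verts H}"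
    using H(1) \<open>subgraph H (G \<restriction> S)\<close> by (auto simp: induced_subgraph_def subgraph_def)
  ultimately have "induced_subgraph H G"
    by (auto simp: induced_subgraph_def)
  with H(2) assms(1) show False
    by (auto simp: induced_free_def)
qed

text \<open>Arcs of \<open>G\<close> are abstract while those of the pattern are pairs, so the
  isomorphism sends an arc to the pair of its pulled-back ends; this is injective because there are
  no multiple arcs. A pattern can thus be exhibited by a vertex map alone.\<close>

lemma (in nomulti_digraph) not_induced_free_with_proj:
  assumes inj: "inj_on f (pverts P)"
    and verts: "f ` pverts P \<subseteq> verts G"
    and arcs: "parcs P \<subseteq> pverts P \<times> pverts P"
    and adj: "\<And>i j. i \<in> pverts P \<Longrightarrow> j \<in> pverts P \<Longrightarrow> f i \<rightarrow>\<^bsub>G\<^esub> f j \<longleftrightarrow> (i, j) \<in> parcs P"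
  shows "\<not> induced_free G (with_proj P)"
proof -
  define H where "H = G \<restriction> f ` pverts P"
  \<comment> \<open>The isomorphism runs from the induced subgraph to the pattern, hence the inverse
    of \<open>f\<close>.\<close>
  define g where "g = the_inv_into (pverts P) f"
  define h where "h = \<lparr>iso_verts = g, iso_arcs = (\<lambda>e. (g (tail G e), g (head G e))),
    iso_head = snd, iso_tail = fst\<rparr>"
  have g: "g (f i) = i" if "i \<in> pverts P" for i
    using that inj by (simp add: g_def the_inv_into_f_f)
  have ind: "induced_subgraph H G"
    unfolding H_def using verts by (rule induced_induce)
  have "wf_digraph H"
    unfolding H_def using wellformed_induce_subgraph .
  moreover have "inj_on (iso_verts h) (verts H)"
    unfolding h_def H_def using g by (auto intro!: inj_onI)
  moreover have "inj_on (iso_arcs h) (arcs H)"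
  proof (rule inj_onI)
    fix d e assume "d \<in> arcs H" "e \<in> arcs H" "iso_arcs h d = iso_arcs h e"
    then have "arc_to_ends G d = arc_to_ends G e"
      by (auto simp: h_def H_def g arc_to_ends_def)
    with \<open>d \<in> arcs H\<close> \<open>e \<in> arcs H\<close> show "d = e"
      by (auto simp: H_def intro: no_multi_arcs)
  qed
  ultimately have "pre_digraph.digraph_isomorphism H h"
    unfolding pre_digraph.digraph_isomorphism_def by (simp add: h_def H_def)
  moreover have "with_proj P = app_iso h H"
  proof -
    have "verts (app_iso h H) = pverts P"
      by (simp add: h_def H_def image_image g)
    moreover have "arcs (app_iso h H) = parcs P"
    proof (intro set_eqI iffI)
      fix p assume "p \<in> arcs (app_iso h H)"
      then obtain e where "e \<in> arcs H" "p = (g (tail G e), g (head G e))"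
        by (auto simp: h_def)
      then obtain i j where "e \<in> arcs G" "i \<in> pverts P" "j \<in> pverts P"
        "tail G e = f i" "head G e = f j" "p = (i, j)"
        by (auto simp: H_def g)
      moreover from this have "f i \<rightarrow>\<^bsub>G\<^esub> f j"
        by (auto simp: arcs_ends_conv intro: rev_image_eqI[of e])
      ultimately show "p \<in> parcs P"
        using adj by blast
    next
      fix p assume p: "p \<in> parcs P"
      then obtain i j where ij: "p = (i, j)" "i \<in> pverts P" "j \<in> pverts P"
        using arcs by blast
      then have "f i \<rightarrow>\<^bsub>G\<^esub> f j"
        using adj p by blast
      then obtain e where "e \<in> arcs G" "tail G e = f i" "head G e = f j"
        by auto
      then have "e \<in> arcs H" "iso_arcs h e = p"
        using ij by (auto simp: H_def h_def g)
      then show "p \<in> arcs (app_iso h H)"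
        by auto
    qed
    ultimately show ?thesis
      by (simp add: with_proj_def app_iso_def h_def)
  qed
  ultimately have "digraph_iso H (with_proj P)"
    by (auto simp: digraph_iso_def)
  with ind show ?thesis
    by (auto simp: induced_free_def)
qed

section \<open>Forbidden patterns, clique bounds and disjoint unions of cliques\<close>

context graph
begin

lemma adj_sym: "u \<rightarrow>\<^bsub>G\<^esub> w \<longleftrightarrow> w \<rightarrow>\<^bsub>G\<^esub> u"
  using sym_arcs arcs_ends_symmetric by metis

lemma adj_irrefl [simp]: "\<not> u \<rightarrow>\<^bsub>G\<^esub> u"
  using adj_not_same by blast

text \<open>The path is \<open>a - b - c\<close>, and \<open>d\<close>, \<open>e\<close> are
  isolated. Adjacency yields the inequalities that are not assumed: there are no loops, and each
  path vertex has a neighbour on the path while \<open>d\<close> and \<open>e\<close> have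
  none.\<close>

lemma P3_2K1_free_False:
  assumes "induced_free G P3_2K1"
    and "a \<rightarrow>\<^bsub>G\<^esub> b" "b \<rightarrow>\<^bsub>G\<^esub> c" "\<not> a \<rightarrow>\<^bsub>G\<^esub> c" "a \<noteq> c"
    and "d \<in> verts G" "e \<in> verts G" "d \<noteq> e" "\<not> d \<rightarrow>\<^bsub>G\<^esub> e"
    and "\<not> d \<rightarrow>\<^bsub>G\<^esub> a" "\<not> d \<rightarrow>\<^bsub>G\<^esub> b" "\<not> d \<rightarrow>\<^bsub>G\<^esub> c"
    and "\<not> e \<rightarrow>\<^bsub>G\<^esub> a" "\<not> e \<rightarrow>\<^bsub>G\<^esub> b" "\<not> e \<rightarrow>\<^bsub>G\<^esub> c"
  shows False
proof -
  let ?f = "(!) [a, b, c, d, e]"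
  let ?P = "\<lparr>pverts = {0, 1, 2, 3, 4 :: nat}, parcs = {(0, 1), (1, 0), (1, 2), (2, 1)}\<rparr>"
  have verts: "set [a, b, c, d, e] \<subseteq> verts G"
    using assms(6,7) adj_in_verts[OF assms(2)] adj_in_verts[OF assms(3)] by simp
  have rev: "b \<rightarrow>\<^bsub>G\<^esub> a" "c \<rightarrow>\<^bsub>G\<^esub> b" "\<not> c \<rightarrow>\<^bsub>G\<^esub> a" "\<not> e \<rightarrow>\<^bsub>G\<^esub> d"
    "\<not> a \<rightarrow>\<^bsub>G\<^esub> d" "\<not> b \<rightarrow>\<^bsub>G\<^esub> d" "\<not> c \<rightarrow>\<^bsub>G\<^esub> d" "\<not> a \<rightarrow>\<^bsub>G\<^esub> e" "\<not> b \<rightarrow>\<^bsub>G\<^esub> e" "\<not> c \<rightarrow>\<^bsub>G\<^esub> e"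
    using assms(2-) adj_sym by blast+
  have dist: "distinct [a, b, c, d, e]"
    using assms(2-) rev by auto
  have "inj_on ?f (pverts ?P)"
    using dist by (auto simp: inj_on_def)
  moreover have "?f ` pverts ?P \<subseteq> verts G"
    using verts by auto
  moreover have "parcs ?P \<subseteq> pverts ?P \<times> pverts ?P"
    by auto
  moreover have "?f i \<rightarrow>\<^bsub>G\<^esub> ?f j \<longleftrightarrow> (i, j) \<in> parcs ?P" if "i \<in> pverts ?P" "j \<in> pverts ?P" for i j
  proof -
    \<comment> \<open>Quantifying over explicit sets lets the simplifier unfold the equivalence into
      its 25 instances.\<close>
    have *: "\<forall>i\<in>{0, 1, 2, 3, 4}. \<forall>j\<in>{0, 1, 2, 3, 4}. ?f i \<rightarrow>\<^bsub>G\<^esub> ?f j \<longleftrightarrow> (i, j) \<in> parcs ?P"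
      by (simp add: assms(2-) rev)
    show ?thesis
      by (rule *[THEN bspec, THEN bspec]) (use that in simp_all)
  qed
  ultimately have "\<not> induced_free G (with_proj ?P)"
    by (rule not_induced_free_with_proj)
  with assms(1) show False
    by (simp add: P3_2K1_def)
qed

text \<open>The pattern is a K4 on \<open>a\<close>, \<open>c\<close>, \<open>d\<close>,
  \<open>e\<close> with \<open>b\<close> joined to just \<open>d\<close> and \<open>e\<close>. The
  two missing edges form the path \<open>a - b - c\<close> of the complement, which explains the
  naming.\<close>

lemma co_P3_2K1_free_False:
  assumes "induced_free G (complement P3_2K1)"
    and "a \<rightarrow>\<^bsub>G\<^esub> c" "a \<rightarrow>\<^bsub>G\<^esub> d" "a \<rightarrow>\<^bsub>G\<^esub> e" "c \<rightarrow>\<^bsub>G\<^esub> d" "c \<rightarrow>\<^bsub>G\<^esub> e" "d \<rightarrow>\<^bsub>G\<^esub> e"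
    and "b \<rightarrow>\<^bsub>G\<^esub> d" "b \<rightarrow>\<^bsub>G\<^esub> e" "\<not> b \<rightarrow>\<^bsub>G\<^esub> a" "\<not> b \<rightarrow>\<^bsub>G\<^esub> c"
  shows False
proof -
  let ?f = "(!) [a, b, c, d, e]"
  let ?P = "\<lparr>pverts = {0, 1, 2, 3, 4 :: nat}, parcs = {(u, v). u \<in> {0, 1, 2, 3, 4} \<and>
    v \<in> {0, 1, 2, 3, 4} \<and> u \<noteq> v \<and> (u, v) \<notin> {(0, 1), (1, 0), (1, 2), (2, 1)}}\<rparr>"
  have verts: "set [a, b, c, d, e] \<subseteq> verts G"
    using adj_in_verts[OF assms(2)] adj_in_verts[OF assms(7)] adj_in_verts[OF assms(8)] by simp
  have rev: "c \<rightarrow>\<^bsub>G\<^esub> a" "d \<rightarrow>\<^bsub>G\<^esub> a" "e \<rightarrow>\<^bsub>G\<^esub> a" "d \<rightarrow>\<^bsub>G\<^esub> c" "e \<rightarrow>\<^bsub>G\<^esub> c" "e \<rightarrow>\<^bsub>G\<^esub> d"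
    "d \<rightarrow>\<^bsub>G\<^esub> b" "e \<rightarrow>\<^bsub>G\<^esub> b" "\<not> a \<rightarrow>\<^bsub>G\<^esub> b" "\<not> c \<rightarrow>\<^bsub>G\<^esub> b"
    using assms(2-) adj_sym by blast+
  have dist: "distinct [a, b, c, d, e]"
    using assms(2-) rev by auto
  have "inj_on ?f (pverts ?P)"
    using dist by (auto simp: inj_on_def)
  moreover have "?f ` pverts ?P \<subseteq> verts G"
    using verts by auto
  moreover have "parcs ?P \<subseteq> pverts ?P \<times> pverts ?P"
    unfolding pair_pre_digraph.select_convs by blast
  moreover have "?f i \<rightarrow>\<^bsub>G\<^esub> ?f j \<longleftrightarrow> (i, j) \<in> parcs ?P" if "i \<in> pverts ?P" "j \<in> pverts ?P" for i j
  proof -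
    have *: "\<forall>i\<in>{0, 1, 2, 3, 4}. \<forall>j\<in>{0, 1, 2, 3, 4}. ?f i \<rightarrow>\<^bsub>G\<^esub> ?f j \<longleftrightarrow> (i, j) \<in> parcs ?P"
      by (simp add: assms(2-) rev)
    show ?thesis
      by (rule *[THEN bspec, THEN bspec]) (use that in simp_all)
  qed
  ultimately have "\<not> induced_free G (with_proj ?P)"
    by (rule not_induced_free_with_proj)
  moreover have "complement P3_2K1 = with_proj ?P"
    by (simp add: complement_def P3_2K1_def)
  ultimately show False
    using assms(1) by simp
qed

lemma finite_cliques: "finite {S. is_clique G S}"
  by (rule finite_subset[of _ "Pow (verts G)"]) (auto simp: is_clique_def)

lemma card_clique_le: "is_clique G S \<Longrightarrow> card S \<le> \<omega> G"
  unfolding clique_number_def using finite_cliques by (intro Max_ge) auto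

text \<open>Without an induced P3, being equal or adjacent is an equivalence relation, and its
  classes are the cliques.\<close>

lemma disjoint_union_of_cliquesI:
  assumes trans: "\<And>a b c. a \<rightarrow>\<^bsub>G\<^esub> b \<Longrightarrow> b \<rightarrow>\<^bsub>G\<^esub> c \<Longrightarrow> a \<noteq> c \<Longrightarrow> a \<rightarrow>\<^bsub>G\<^esub> c"
  shows "disjoint_union_of_cliques G"
proof -
  define r where "r = {(a, b). a \<in> verts G \<and> b \<in> verts G \<and> (a = b \<or> a \<rightarrow>\<^bsub>G\<^esub> b)}"
  have r: "equiv (verts G) r"
  proof (rule equivI)
    show "r \<subseteq> verts G \<times> verts G" "refl_on (verts G) r"
      by (auto simp: r_def refl_on_def)
    show "sym r"
      using adj_sym by (auto simp: r_def sym_def)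
    show "trans r"
      using trans by (auto simp: r_def trans_def)
  qed
  have "is_clique G S" if "S \<in> verts G // r" for S
  proof -
    have "S \<subseteq> verts G"
      using that by (auto simp: quotient_def r_def)
    moreover have "(a, b) \<in> r" if "a \<in> S" "b \<in> S" for a b
      using quotient_eq_iff[OF r \<open>S \<in> _\<close> \<open>S \<in> _\<close>] that by blast
    ultimately show ?thesis
      by (auto simp: is_clique_def pairwise_def r_def)
  qed
  moreover have "\<not> a \<rightarrow>\<^bsub>G\<^esub> b"
    if "S \<in> verts G // r" "T \<in> verts G // r" "S \<noteq> T" "a \<in> S" "b \<in> T" for S T a b
    using quotient_eq_iff[OF r that(1,2,4,5)] that(3) adj_in_verts
    by (auto simp: r_def)
  ultimately show ?thesis
    unfolding disjoint_union_of_cliques_def using partition_on_quotient[OF r] by blast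
qed

end

section \<open>The parts attached to a maximum clique\<close>

text \<open>Interpreted twice: for the whole graph with \<open>A\<close>, and for the subgraph
  induced by \<open>V2\<close> with \<open>A'\<close>.\<close>

locale max_clique = graph G for G :: "('a, 'b) pre_digraph" (structure) +
  fixes A :: "'a set" and v :: "nat \<Rightarrow> 'a"
  assumes maximum: "maximum_clique G A"
    and bij: "bij_betw v {1..\<omega> G} A"
begin

text \<open>A partite class of \<open>X\<close>: having no loop, \<open>v k\<close> also misses
  exactly \<open>v k\<close> among the clique vertices.\<close>

definition part :: "nat \<Rightarrow> 'a set" where
  "part k = insert (v k) (missing_only G v (\<omega> G) k)"

definition X :: "'a set" where
  "X = A \<union> (\<Union>k\<in>{1..\<omega> G}. missing_only G v (\<omega> G) k)"

lemma image_v: "v ` {1..\<omega> G} = A"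
  using bij by (rule bij_betw_imp_surj_on)

lemma v_in: "k \<in> {1..\<omega> G} \<Longrightarrow> v k \<in> A"
  using image_v by blast

lemma v_eq_iff: "i \<in> {1..\<omega> G} \<Longrightarrow> j \<in> {1..\<omega> G} \<Longrightarrow> v i = v j \<longleftrightarrow> i = j"
  using bij inj_on_eq_iff by (metis bij_betw_def)

lemma A_subset: "A \<subseteq> verts G"
  using maximum by (simp add: maximum_clique_def is_clique_def)

lemma finite_A: "finite A"
  using A_subset finite_verts by (rule finite_subset)

lemma card_A: "card A = \<omega> G"
  using maximum by (simp add: maximum_clique_def)

lemma A_adj: "u \<in> A \<Longrightarrow> w \<in> A \<Longrightarrow> u \<noteq> w \<Longrightarrow> u \<rightarrow>\<^bsub>G\<^esub> w"
  using maximum by (auto simp: maximum_clique_def is_clique_def pairwise_def)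

lemma X_eq: "X = (\<Union>k\<in>{1..\<omega> G}. part k)"
  unfolding X_def part_def using image_v by blast

lemma X_subset: "X \<subseteq> verts G"
  using A_subset by (auto simp: X_def missing_only_def)

lemma missing_onlyD:
  assumes "x \<in> missing_only G v (\<omega> G) k"
  shows "x \<in> verts G" "x \<notin> A" "\<not> x \<rightarrow>\<^bsub>G\<^esub> v k"
    "\<And>i. i \<in> {1..\<omega> G} \<Longrightarrow> i \<noteq> k \<Longrightarrow> x \<rightarrow>\<^bsub>G\<^esub> v i"
  using assms image_v by (auto simp: missing_only_def)

section \<open>The multipartite structure of \<open>X\<close>\<close>

lemma part_adj:
  assumes "x \<in> part k" "k \<in> {1..\<omega> G}" "i \<in> {1..\<omega> G}"
  shows "x \<rightarrow>\<^bsub>G\<^esub> v i \<longleftrightarrow> i \<noteq> k"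
  using assms missing_onlyD[of x k] A_adj[of "v k" "v i"] v_in v_eq_iff
  by (auto simp: part_def)

text \<open>Exchanging \<open>v k\<close> for two adjacent vertices of its part would give a clique
  with \<open>\<omega> G + 1\<close> vertices.\<close>

lemma part_independent:
  assumes k: "k \<in> {1..\<omega> G}" and x: "x \<in> part k" and y: "y \<in> part k"
  shows "\<not> x \<rightarrow>\<^bsub>G\<^esub> y"
proof
  assume xy: "x \<rightarrow>\<^bsub>G\<^esub> y"
  \<comment> \<open>No edge inside the part meets \<open>v k\<close>, since every vertex of the part
    misses \<open>v k\<close>.\<close>
  have "x \<in> missing_only G v (\<omega> G) k" "y \<in> missing_only G v (\<omega> G) k"
    using xy x y part_adj[OF x k k] part_adj[OF y k k] adj_sym by (auto simp: part_def)
  note xm = missing_onlyD[OF this(1)] and ym = missing_onlyD[OF this(2)]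
  have adj: "x \<rightarrow>\<^bsub>G\<^esub> u" "y \<rightarrow>\<^bsub>G\<^esub> u" if u: "u \<in> A - {v k}" for u
  proof -
    obtain i where i: "i \<in> {1..\<omega> G}" "u = v i"
      using u image_v by blast
    moreover have "i \<noteq> k"
      using i u by blast
    ultimately show "x \<rightarrow>\<^bsub>G\<^esub> u" "y \<rightarrow>\<^bsub>G\<^esub> u"
      using xm(4) ym(4) by blast+
  qed
  have "is_clique G (insert x (insert y (A - {v k})))"
    unfolding is_clique_def pairwise_def
    using xm(1) ym(1) A_subset adj adj_sym xy A_adj by auto
  moreover have "card (insert x (insert y (A - {v k}))) = Suc (\<omega> G)"
    using xm(2) ym(2) xy finite_A card_A v_in[OF k] k
    by (auto simp: card_insert_if card_Diff_singleton_if)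
  ultimately show False
    using card_clique_le by fastforce
qed

text \<open>The index is recovered from the only clique vertex that \<open>x\<close> misses.\<close>

lemma part_disjoint:
  assumes "i \<in> {1..\<omega> G}" "j \<in> {1..\<omega> G}" "x \<in> part i" "x \<in> part j"
  shows "i = j"
  using part_adj[OF assms(3,1,2)] part_adj[OF assms(4,2,2)] by auto

lemma part_partition: "partite_classes (G \<restriction> X) (part ` {1..\<omega> G})"
  unfolding partite_classes_def
proof
  show "partition_on (verts (G \<restriction> X)) (part ` {1..\<omega> G})"
  proof (rule partition_onI)
    show "\<Union> (part ` {1..\<omega> G}) = verts (G \<restriction> X)"
      by (simp add: X_eq)
    show "disjnt S T" if "S \<in> part ` {1..\<omega> G}" "T \<in> part ` {1..\<omega> G}" "S \<noteq> T" for S T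
      using that part_disjoint unfolding disjnt_iff by blast
    show "{} \<notin> part ` {1..\<omega> G}"
      by (auto simp: part_def)
  qed
  show "\<forall>S\<in>part ` {1..\<omega> G}. is_independent (G \<restriction> X) S"
    using part_independent by (auto simp: is_independent_def pairwise_def dominates_induce_iff X_eq)
qed

lemma multipartite_X: "multipartite (\<omega> G) (G \<restriction> X)"
proof -
  have "inj_on part {1..\<omega> G}"
  proof (rule inj_onI)
    fix i j assume "i \<in> {1..\<omega> G}" "j \<in> {1..\<omega> G}" "part i = part j"
    moreover have "v i \<in> part i"
      by (simp add: part_def)
    ultimately show "i = j"
      using part_disjoint by blast
  qed
  then have "card (part ` {1..\<omega> G}) = \<omega> G"
    by (simp add: card_image)
  then show ?thesis
    unfolding multipartite_def using part_partition by blast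
qed

text \<open>If \<open>x\<close> and \<open>y\<close> from parts \<open>k\<close> and
  \<open>l\<close> were not adjacent, then \<open>x\<close>, \<open>v l\<close>, \<open>v i\<close>,
  \<open>v j\<close> would be a K4 of which \<open>y\<close> sees just \<open>v i\<close> and
  \<open>v j\<close>.\<close>

lemma complete_multipartite_X:
  assumes co_free: "induced_free G (complement P3_2K1)" and "\<omega> G \<ge> 4"
  shows "complete_multipartite (G \<restriction> X)"
proof -
  have adj: "x \<rightarrow>\<^bsub>G\<^esub> y"
    if k: "k \<in> {1..\<omega> G}" and l: "l \<in> {1..\<omega> G}" and "k \<noteq> l" and x: "x \<in> part k" and y: "y \<in> part l"
    for k l x y
  proof (rule ccontr)
    assume "\<not> x \<rightarrow>\<^bsub>G\<^esub> y"
    \<comment> \<open>The bound \<open>\<omega> G \<ge> 4\<close> supplies two indices besides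
      \<open>k\<close> and \<open>l\<close>.\<close>
    have "card ({1..\<omega> G} - {k, l}) \<ge> 2"
      using \<open>\<omega> G \<ge> 4\<close> k l \<open>k \<noteq> l\<close> by (subst card_Diff_subset) auto
    then obtain J where "J \<subseteq> {1..\<omega> G} - {k, l}" "card J = 2"
      by (rule obtain_subset_with_card_n)
    moreover from this(2) obtain i j where "J = {i, j}" "i \<noteq> j"
      by (auto simp: card_2_iff)
    ultimately have i: "i \<in> {1..\<omega> G}" "i \<noteq> k" "i \<noteq> l" and j: "j \<in> {1..\<omega> G}" "j \<noteq> k" "j \<noteq> l"
      by auto
    show False
    proof (rule co_P3_2K1_free_False[OF co_free, of x "v l" "v i" "v j" y])
      show "x \<rightarrow>\<^bsub>G\<^esub> v l" "x \<rightarrow>\<^bsub>G\<^esub> v i" "x \<rightarrow>\<^bsub>G\<^esub> v j"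
        using part_adj[OF x k] i j l \<open>k \<noteq> l\<close> by auto
      show "v l \<rightarrow>\<^bsub>G\<^esub> v i" "v l \<rightarrow>\<^bsub>G\<^esub> v j" "v i \<rightarrow>\<^bsub>G\<^esub> v j"
        using A_adj v_in v_eq_iff i j l \<open>i \<noteq> j\<close> by auto
      show "y \<rightarrow>\<^bsub>G\<^esub> v i" "y \<rightarrow>\<^bsub>G\<^esub> v j" "\<not> y \<rightarrow>\<^bsub>G\<^esub> v l"
        using part_adj[OF y l] i j l by auto
      show "\<not> y \<rightarrow>\<^bsub>G\<^esub> x"
        using \<open>\<not> x \<rightarrow>\<^bsub>G\<^esub> y\<close> adj_sym by blast
    qed
  qed
  have "\<forall>S\<in>part ` {1..\<omega> G}. \<forall>T\<in>part ` {1..\<omega> G}. S \<noteq> T \<longrightarrow>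
      (\<forall>u\<in>S. \<forall>w\<in>T. u \<rightarrow>\<^bsub>G \<restriction> X\<^esub> w)"
  proof (intro ballI impI)
    fix S T u w
    assume "S \<in> part ` {1..\<omega> G}" "T \<in> part ` {1..\<omega> G}" "S \<noteq> T" and uw: "u \<in> S" "w \<in> T"
    then obtain k l where kl: "k \<in> {1..\<omega> G}" "l \<in> {1..\<omega> G}" "k \<noteq> l" "S = part k" "T = part l"
      by blast
    then have "u \<rightarrow>\<^bsub>G\<^esub> w" "u \<in> X" "w \<in> X"
      using adj uw X_eq by blast+
    then show "u \<rightarrow>\<^bsub>G \<restriction> X\<^esub> w"
      by (simp add: dominates_induce_iff)
  qed
  then show ?thesis
    unfolding complete_multipartite_def using part_partition by blast
qed

section \<open>Vertices outside \<open>X\<close> and their neighbours in \<open>A\<close>\<close>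

text \<open>With no non-neighbour in \<open>A\<close>, \<open>x\<close> would enlarge the maximum
  clique; with exactly one, it would belong to a part of \<open>X\<close>.\<close>

lemma outside_two_nonneighbours:
  assumes x: "x \<in> verts G - X"
  obtains p q where "p \<in> A" "q \<in> A" "p \<noteq> q" "\<not> x \<rightarrow>\<^bsub>G\<^esub> p" "\<not> x \<rightarrow>\<^bsub>G\<^esub> q"
proof -
  have "x \<notin> A" and x_miss: "\<And>k. k \<in> {1..\<omega> G} \<Longrightarrow> x \<notin> missing_only G v (\<omega> G) k"
    using x by (auto simp: X_def)
  have "\<exists>p\<in>A. \<not> x \<rightarrow>\<^bsub>G\<^esub> p"
  proof (rule ccontr)
    assume "\<not> (\<exists>p\<in>A. \<not> x \<rightarrow>\<^bsub>G\<^esub> p)"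
    then have "is_clique G (insert x A)"
      using x A_subset A_adj adj_sym by (auto simp: is_clique_def pairwise_def)
    from card_clique_le[OF this] show False
      using \<open>x \<notin> A\<close> finite_A card_A by simp
  qed
  then obtain p where p: "p \<in> A" "\<not> x \<rightarrow>\<^bsub>G\<^esub> p"
    by blast
  then obtain k where k: "k \<in> {1..\<omega> G}" "p = v k"
    using image_v by blast
  with x_miss[OF k(1)] p(2) x \<open>x \<notin> A\<close> obtain i
    where "i \<in> {1..\<omega> G}" "i \<noteq> k" "\<not> x \<rightarrow>\<^bsub>G\<^esub> v i"
    unfolding missing_only_def image_v by blast
  then show thesis
    using that[of p "v i"] p k v_in v_eq_iff by auto
qed

text \<open>Two neighbours and two non-neighbours of \<open>x\<close> in \<open>A\<close> would form
  a K4 giving the second forbidden pattern. The four vertices are found from \<open>x\<close>, so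
  this also applies to a clique \<open>A'\<close> of unknown size.\<close>

lemma outside_neighbour_unique:
  assumes co_free: "induced_free G (complement P3_2K1)"
    and x: "x \<in> verts G - X"
    and u: "u \<in> A" "x \<rightarrow>\<^bsub>G\<^esub> u" and w: "w \<in> A" "x \<rightarrow>\<^bsub>G\<^esub> w"
  shows "u = w"
proof (rule ccontr)
  assume "u \<noteq> w"
  obtain p q where pq: "p \<in> A" "q \<in> A" "p \<noteq> q" "\<not> x \<rightarrow>\<^bsub>G\<^esub> p" "\<not> x \<rightarrow>\<^bsub>G\<^esub> q"
    using outside_two_nonneighbours[OF x] by blast
  with u w have "p \<noteq> u" "p \<noteq> w" "q \<noteq> u" "q \<noteq> w"
    by auto
  then show False
    using co_P3_2K1_free_False[OF co_free, of p q u w x] pq u w \<open>u \<noteq> w\<close> A_adj by blast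
qed

text \<open>Pigeonhole: each vertex of \<open>T\<close> sees at most one vertex of \<open>A\<close>,
  so fewer than \<open>\<omega> G\<close> of them cannot cover \<open>A\<close>.\<close>

lemma common_nonneighbour:
  assumes co_free: "induced_free G (complement P3_2K1)"
    and T: "T \<subseteq> verts G - X" "finite T" "card T < \<omega> G"
  obtains w where "w \<in> A" "\<And>x. x \<in> T \<Longrightarrow> \<not> x \<rightarrow>\<^bsub>G\<^esub> w"
proof -
  let ?N = "\<lambda>x. {w \<in> A. x \<rightarrow>\<^bsub>G\<^esub> w}"
  have "card (?N x) \<le> 1" if "x \<in> T" for x
  proof -
    have "x \<in> verts G - X"
      using that T(1) by blast
    then have "\<forall>u\<in>?N x. \<forall>w\<in>?N x. u = w"
      using outside_neighbour_unique[OF co_free] by blast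
    then show ?thesis
      using finite_A by (simp add: card_le_Suc0_iff_eq)
  qed
  then have "(\<Sum>x\<in>T. card (?N x)) \<le> card T"
    using sum_mono[of T "\<lambda>x. card (?N x)" "\<lambda>_. 1"] by simp
  then have "card (\<Union>x\<in>T. ?N x) < card A"
    using card_UN_le[OF T(2), of ?N] T(3) card_A by linarith
  then have "\<not> A \<subseteq> (\<Union>x\<in>T. ?N x)"
    using card_mono[of "\<Union>x\<in>T. ?N x" A] T(2) finite_A by auto
  then show thesis
    using that by blast
qed

text \<open>Otherwise take \<open>w\<close> in \<open>A\<close> missed by the whole triple:
  \<open>x - u - w\<close> is an induced P3, and \<open>y\<close>, \<open>z\<close> are isolated
  from it.\<close>

lemma independent_triple_shared:
  assumes free: "induced_free G P3_2K1" and co_free: "induced_free G (complement P3_2K1)"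
    and "\<omega> G \<ge> 4"
    and out: "x \<in> verts G - X" "y \<in> verts G - X" "z \<in> verts G - X"
    and "x \<noteq> y" "x \<noteq> z" "y \<noteq> z"
    and nadj: "\<not> x \<rightarrow>\<^bsub>G\<^esub> y" "\<not> x \<rightarrow>\<^bsub>G\<^esub> z" "\<not> y \<rightarrow>\<^bsub>G\<^esub> z"
    and u: "u \<in> A" "x \<rightarrow>\<^bsub>G\<^esub> u"
  shows "y \<rightarrow>\<^bsub>G\<^esub> u \<or> z \<rightarrow>\<^bsub>G\<^esub> u"
proof (rule ccontr)
  assume no: "\<not> (y \<rightarrow>\<^bsub>G\<^esub> u \<or> z \<rightarrow>\<^bsub>G\<^esub> u)"
  have "card {x, y, z} < \<omega> G"
    using \<open>\<omega> G \<ge> 4\<close> by (auto simp: card_insert_if)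
  then obtain w where w: "w \<in> A" "\<And>t. t \<in> {x, y, z} \<Longrightarrow> \<not> t \<rightarrow>\<^bsub>G\<^esub> w"
    using common_nonneighbour[OF co_free, of "{x, y, z}"] out by blast
  then have "u \<rightarrow>\<^bsub>G\<^esub> w"
    using u A_adj by blast
  moreover have "x \<noteq> w"
    using w(1) out(1) by (auto simp: X_def)
  ultimately show False
    using P3_2K1_free_False[OF free, of x u w y z] u w out no nadj \<open>y \<noteq> z\<close> adj_sym by blast
qed

text \<open>The triple \<open>x\<close>, \<open>z\<close>, \<open>t\<close> is independent, so its
  neighbours in \<open>A\<close> are shared and reduce to at most one vertex. Some \<open>w\<close>
  in \<open>A\<close> is then missed by all of \<open>x\<close>, \<open>y\<close>, \<open>z\<close>,
  \<open>t\<close> and serves as the second isolated vertex.\<close>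

lemma outside_P3_K1_free:
  assumes free: "induced_free G P3_2K1" and co_free: "induced_free G (complement P3_2K1)"
    and "\<omega> G \<ge> 4"
    and out: "x \<in> verts G - X" "y \<in> verts G - X" "z \<in> verts G - X" "t \<in> verts G - X"
    and P3: "x \<rightarrow>\<^bsub>G\<^esub> y" "y \<rightarrow>\<^bsub>G\<^esub> z" "\<not> x \<rightarrow>\<^bsub>G\<^esub> z" "x \<noteq> z"
    and t: "\<not> t \<rightarrow>\<^bsub>G\<^esub> x" "\<not> t \<rightarrow>\<^bsub>G\<^esub> y" "\<not> t \<rightarrow>\<^bsub>G\<^esub> z"
  shows False
proof -
  have ne: "t \<noteq> x" "t \<noteq> z"
    using P3 t adj_sym by blast+
  note shared = independent_triple_shared[OF free co_free \<open>\<omega> G \<ge> 4\<close>]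
  note unique = outside_neighbour_unique[OF co_free]
  have x_shared: "z \<rightarrow>\<^bsub>G\<^esub> u \<or> t \<rightarrow>\<^bsub>G\<^esub> u" if "u \<in> A" "x \<rightarrow>\<^bsub>G\<^esub> u" for u
    using shared[of x z t u] out that P3(3,4) t(1,3) ne adj_sym by blast
  have z_shared: "x \<rightarrow>\<^bsub>G\<^esub> u \<or> t \<rightarrow>\<^bsub>G\<^esub> u" if "u \<in> A" "z \<rightarrow>\<^bsub>G\<^esub> u" for u
    using shared[of z x t u] out that P3(3,4) t(1,3) ne adj_sym by blast
  have t_shared: "x \<rightarrow>\<^bsub>G\<^esub> u \<or> z \<rightarrow>\<^bsub>G\<^esub> u" if "u \<in> A" "t \<rightarrow>\<^bsub>G\<^esub> u" for u
    using shared[of t x z u] out that P3(3,4) t(1,3) ne adj_sym by blast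
  \<comment> \<open>\<open>s\<close> sees whatever the triple sees in \<open>A\<close>, so only
    \<open>y\<close> and \<open>s\<close> have to be avoided.\<close>
  obtain s where s: "s \<in> {x, z}"
    "\<And>u r. u \<in> A \<Longrightarrow> r \<in> {x, z, t} \<Longrightarrow> r \<rightarrow>\<^bsub>G\<^esub> u \<Longrightarrow> s \<rightarrow>\<^bsub>G\<^esub> u"
  proof (cases "\<exists>u\<in>A. x \<rightarrow>\<^bsub>G\<^esub> u")
    case True
    then obtain u where u: "u \<in> A" "x \<rightarrow>\<^bsub>G\<^esub> u"
      by blast
    \<comment> \<open>By sharing, \<open>z\<close> or \<open>t\<close> sees \<open>u\<close>. If
      \<open>x\<close> missed \<open>w\<close>, both \<open>z\<close> and \<open>t\<close> would see
      \<open>w\<close>, and uniqueness would force \<open>w = u\<close>.\<close>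
    have "x \<rightarrow>\<^bsub>G\<^esub> w" if "w \<in> A" "r \<in> {x, z, t}" "r \<rightarrow>\<^bsub>G\<^esub> w" for r w
      using that x_shared[OF u] u z_shared[of w] t_shared[of w]
        unique[OF out(3), of u w] unique[OF out(4), of u w] by blast
    then show thesis
      using that[of x] by blast
  next
    case False
    then show thesis
      using that[of z] t_shared by blast
  qed
  have "card {y, s} < \<omega> G"
    using \<open>\<omega> G \<ge> 4\<close> by (auto simp: card_insert_if)
  moreover have "{y, s} \<subseteq> verts G - X"
    using out s(1) by blast
  ultimately obtain w where w: "w \<in> A" "\<And>r. r \<in> {y, s} \<Longrightarrow> \<not> r \<rightarrow>\<^bsub>G\<^esub> w"
    using common_nonneighbour[OF co_free, of "{y, s}"] by blast
  then have "\<not> x \<rightarrow>\<^bsub>G\<^esub> w" "\<not> z \<rightarrow>\<^bsub>G\<^esub> w" "\<not> t \<rightarrow>\<^bsub>G\<^esub> w"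
    using s(2) by blast+
  moreover have "t \<noteq> w" "w \<in> verts G"
    using w(1) out(4) A_subset by (auto simp: X_def)
  ultimately show False
    using P3_2K1_free_False[OF free P3, of t w] w(2) out(4) t adj_sym by blast
qed

text \<open>Freeness from P3 + K1 is a hypothesis here because it is inherited from the first stage,
  whatever the size of the second clique. It makes every vertex of the clique a neighbour of
  \<open>a\<close>, \<open>b\<close> or \<open>c\<close>.\<close>

lemma P3_K1_free_outside_trans:
  assumes co_free: "induced_free G (complement P3_2K1)"
    and P3_K1_free: "\<And>x y z t. \<lbrakk>x \<rightarrow>\<^bsub>G\<^esub> y; y \<rightarrow>\<^bsub>G\<^esub> z; \<not> x \<rightarrow>\<^bsub>G\<^esub> z; x \<noteq> z; t \<in> verts G;
      \<not> t \<rightarrow>\<^bsub>G\<^esub> x; \<not> t \<rightarrow>\<^bsub>G\<^esub> y; \<not> t \<rightarrow>\<^bsub>G\<^esub> z\<rbrakk> \<Longrightarrow> False"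
    and out: "a \<in> verts G - X" "b \<in> verts G - X" "c \<in> verts G - X"
    and ab: "a \<rightarrow>\<^bsub>G\<^esub> b" and bc: "b \<rightarrow>\<^bsub>G\<^esub> c" and "a \<noteq> c"
  shows "a \<rightarrow>\<^bsub>G\<^esub> c"
proof (rule ccontr)
  assume ac: "\<not> a \<rightarrow>\<^bsub>G\<^esub> c"
  note unique = outside_neighbour_unique[OF co_free]
  have cover: "a \<rightarrow>\<^bsub>G\<^esub> w \<or> b \<rightarrow>\<^bsub>G\<^esub> w \<or> c \<rightarrow>\<^bsub>G\<^esub> w" if "w \<in> A" for w
    using P3_K1_free[OF ab bc ac \<open>a \<noteq> c\<close>, of w] that A_subset adj_sym by blast
  \<comment> \<open>A vertex \<open>r\<close> missed by \<open>b\<close> and different from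
    \<open>q\<close> is missed by \<open>c\<close> too, so \<open>a\<close> sees it. Then
    \<open>a - r - p\<close> is an induced P3 with \<open>c\<close> isolated from it.\<close>
  have matched: False
    if p: "p \<in> A" "\<not> a \<rightarrow>\<^bsub>G\<^esub> p" "b \<rightarrow>\<^bsub>G\<^esub> p" and q: "q \<in> A" "c \<rightarrow>\<^bsub>G\<^esub> q" and "p \<noteq> q" for p q
  proof -
    obtain r where r: "r \<in> A" "r \<noteq> q" "\<not> b \<rightarrow>\<^bsub>G\<^esub> r"
      using outside_two_nonneighbours[OF out(2)] by metis
    have nc: "\<not> c \<rightarrow>\<^bsub>G\<^esub> r" "\<not> c \<rightarrow>\<^bsub>G\<^esub> p"
      using unique[OF out(3)] r q p \<open>p \<noteq> q\<close> by blast+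
    then have "a \<rightarrow>\<^bsub>G\<^esub> r"
      using cover r by blast
    moreover have "r \<rightarrow>\<^bsub>G\<^esub> p"
      using A_adj r p by blast
    moreover have "a \<noteq> p"
      using p out(1) by (auto simp: X_def)
    ultimately show False
      using P3_K1_free[of a r p c] p ac nc out(3) adj_sym by blast
  qed
  obtain p q where pq: "p \<in> A" "q \<in> A" "p \<noteq> q" "\<not> a \<rightarrow>\<^bsub>G\<^esub> p" "\<not> a \<rightarrow>\<^bsub>G\<^esub> q"
    using outside_two_nonneighbours[OF out(1)] by blast
  \<comment> \<open>Each of \<open>p\<close>, \<open>q\<close> is seen by \<open>b\<close> or
    \<open>c\<close>, and neither of these sees both, so \<open>matched\<close> applies in one of
    the two orders.\<close>
  show False
    using cover[OF pq(1)] cover[OF pq(2)] pq matched[of p q] matched[of q p]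
      unique[OF out(2), of p q] unique[OF out(3), of p q] by blast
qed

end

section \<open>The two-stage decomposition\<close>

theorem theorem3p7:
  fixes G :: "('a, 'b) pre_digraph"
    and A A' X1 V2 X2 X3 :: "'a set" and v v' :: "nat \<Rightarrow> 'a" and m :: nat
  assumes "graph G"
    and "induced_free G P3_2K1"
    and "induced_free G (complement P3_2K1)"
    and "\<omega> G \<ge> 4"
    and "maximum_clique G A"
    and "bij_betw v {1..\<omega> G} A"
    and "X1 = A \<union> (\<Union>k\<in>{1..\<omega> G}. missing_only G v (\<omega> G) k)"
    and "V2 = verts G - X1"
    and "m = \<omega> (G \<restriction> V2)"
    and "maximum_clique (G \<restriction> V2) A'"
    and "bij_betw v' {1..m} A'"
    and "X2 = A' \<union> (\<Union>k\<in>{1..m}. missing_only (G \<restriction> V2) v' m k)"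
    and "X3 = V2 - X2"
  shows "verts G = X1 \<union> X2 \<union> X3
    \<and> complete_multipartite (G \<restriction> X1)
    \<and> multipartite m (G \<restriction> X2)
    \<and> (m \<ge> 4 \<longrightarrow> complete_multipartite (G \<restriction> X2))
    \<and> disjoint_union_of_cliques (G \<restriction> X3)"
proof -
  interpret max_clique G A v
    using assms(1,5,6) by (simp add: max_clique_def max_clique_axioms_def)
  have X1: "X1 = X"
    using assms(7) by (simp add: X_def)
  define H where "H = G \<restriction> V2"
  have V2: "V2 \<subseteq> verts G" "verts H = V2"
    using assms(8) by (auto simp: H_def)
  interpret H: max_clique H A' v'
    using assms(9-11) graph_induce[OF V2(1)]
    by (simp add: max_clique_def max_clique_axioms_def H_def)
  have m: "m = \<omega> H"
    using assms(9) by (simp add: H_def)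
  have X2: "X2 = H.X"
    using assms(12)[folded H_def] m by (simp add: H.X_def)
  have H_adj: "u \<rightarrow>\<^bsub>H\<^esub> w \<longleftrightarrow> u \<in> V2 \<and> w \<in> V2 \<and> u \<rightarrow>\<^bsub>G\<^esub> w" for u w
    by (simp add: H_def dominates_induce_iff)
  have X2_V2: "X2 \<subseteq> V2"
    using X2 H.X_subset V2(2) by simp
  have X2_induce: "G \<restriction> X2 = H \<restriction> H.X"
    using X2_V2 by (simp add: X2 H_def induce_induce)
  have co_free: "induced_free H (complement P3_2K1)"
    unfolding H_def using assms(3) V2(1) by (rule induced_free_induce)
  \<comment> \<open>All vertices of \<open>H\<close> lie outside \<open>X1\<close>, so the first
    stage with \<open>\<omega> G \<ge> 4\<close> applies, independently of \<open>m\<close>.\<close>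
  have H_P3_K1_free: False
    if "x \<rightarrow>\<^bsub>H\<^esub> y" "y \<rightarrow>\<^bsub>H\<^esub> z" "\<not> x \<rightarrow>\<^bsub>H\<^esub> z" "x \<noteq> z" "t \<in> verts H"
      "\<not> t \<rightarrow>\<^bsub>H\<^esub> x" "\<not> t \<rightarrow>\<^bsub>H\<^esub> y" "\<not> t \<rightarrow>\<^bsub>H\<^esub> z" for x y z t
    using outside_P3_K1_free[OF assms(2-4), of x y z t] that
    by (auto simp: H_adj V2(2) assms(8) X1)
  have X3: "X3 = verts H - H.X"
    using assms(13) V2(2) X2 by simp
  have X3_subset: "X3 \<subseteq> verts G"
    using X3 V2 by auto
  interpret X3: graph "G \<restriction> X3"
    using graph_induce[OF X3_subset] .
  have X3_adj: "a \<rightarrow>\<^bsub>G \<restriction> X3\<^esub> b \<longleftrightarrow> a \<in> X3 \<and> b \<in> X3 \<and> a \<rightarrow>\<^bsub>H\<^esub> b" for a b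
    using X3 V2(2) by (auto simp: dominates_induce_iff H_adj)
  have "disjoint_union_of_cliques (G \<restriction> X3)"
  proof (rule X3.disjoint_union_of_cliquesI)
    fix a b c
    assume "a \<rightarrow>\<^bsub>G \<restriction> X3\<^esub> b" "b \<rightarrow>\<^bsub>G \<restriction> X3\<^esub> c" "a \<noteq> c"
    then have abc: "a \<in> verts H - H.X" "b \<in> verts H - H.X" "c \<in> verts H - H.X"
      "a \<rightarrow>\<^bsub>H\<^esub> b" "b \<rightarrow>\<^bsub>H\<^esub> c" "a \<noteq> c"
      unfolding X3_adj X3[symmetric] by blast+
    have "a \<rightarrow>\<^bsub>H\<^esub> c"
      by (rule H.P3_K1_free_outside_trans[OF co_free _ abc]) (rule H_P3_K1_free)
    with abc show "a \<rightarrow>\<^bsub>G \<restriction> X3\<^esub> c"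
      unfolding X3_adj X3[symmetric] by blast
  qed
  moreover have "verts G = X1 \<union> X2 \<union> X3"
    using assms(8,13) X1 X_subset X2_V2 by auto
  moreover have "complete_multipartite (G \<restriction> X1)"
    unfolding X1 using assms(3,4) by (rule complete_multipartite_X)
  moreover have "multipartite m (G \<restriction> X2)"
    unfolding X2_induce m by (rule H.multipartite_X)
  moreover have "m \<ge> 4 \<longrightarrow> complete_multipartite (G \<restriction> X2)"
    unfolding X2_induce m using H.complete_multipartite_X[OF co_free] by blast
  ultimately show ?thesis
    by blast
qed

end
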